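(* Let $n\ge2$ be an integer and $$\mathbb{H}_2^n=\left\{\frac{\mathbf{z}}{\|\mathbf{z}\|}\in\mathbb{S}^n:\mathbf{z}\in\{-1,0,1\}^n,\ \|\mathbf{z}\|\ne0\right\}.$$ Then $$\mathbb{H}_2^n\in\mathbb{T}\left(n,\frac{2}{\sqrt{\ln n+5}},3^n\right).$$
   Context: $\|\cdot\|$ is the Euclidean norm and $\mathbb{S}^n=\{\mathbf{x}\in\mathbb{R}^n:\|\mathbf{x}\|=1\}$. For $\mathbf{v}\in\mathbb{S}^n$ and $-1\le\tau\le1$ let $\mathbb{B}^n(\mathbf{v},\tau)=\{\mathbf{x}\in\mathbb{S}^n:\mathbf{x}^{\rm T}\mathbf{v}\ge\tau\}$. A finite set $\mathbb{H}^n\subseteq\mathbb{S}^n$ is a $\tau$-hitting set if $\bigcup_{\mathbf{v}\in\mathbb{H}^n}\mathbb{B}^n(\mathbf{v},\tau)=\mathbb{S}^n$; $\mathbb{T}(n,\tau,m)$ is the collection of all $\tau$-hitting sets of $\mathbb{S}^n$ with at most $m$ elements. *)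

theory Defs
  imports "HOL-Analysis.Analysis"
begin

text \<open>
  The dimension \<open>n\<close> is \<open>CARD('n)\<close>. The unit sphere \<open>S^n\<close> of \<open>R^n\<close> (so superscript \<open>n\<close> is the
  dimension of the ambient space) is \<open>sphere (0 :: real ^ 'n) 1\<close>.
\<close>

definition sphere_cap :: "real ^ 'n \<Rightarrow> real \<Rightarrow> (real ^ 'n) set" where
  "sphere_cap v \<tau> = {x \<in> sphere 0 1. x \<bullet> v \<ge> \<tau>}"

definition hitting_set :: "real \<Rightarrow> (real ^ 'n) set \<Rightarrow> bool" where
  "hitting_set \<tau> H \<longleftrightarrow>
     finite H \<and> H \<subseteq> sphere 0 1 \<and> (\<Union>v\<in>H. sphere_cap v \<tau>) = sphere 0 1"

definition hitting_sets :: "real \<Rightarrow> nat \<Rightarrow> (real ^ 'n) set set" where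
  "hitting_sets \<tau> m = {H. hitting_set \<tau> H \<and> card H \<le> m}"

definition H2 :: "(real ^ 'n) set" where
  "H2 = {z /\<^sub>R norm z | z. (\<forall>i. z $ i \<in> {-1, 0, 1}) \<and> norm z \<noteq> 0}"

end

theory Submission
  imports Defs
begin

text \<open>
  Let \<open>x\<close> be a unit vector and let \<open>a 0 \<ge> a 1 \<ge> \<dots> \<ge> a (n - 1) \<ge> 0\<close> be the absolute values of its
  coordinates in decreasing order. If \<open>z\<close> carries the signs of the \<open>k\<close> largest
  coordinates of \<open>x\<close> and is zero elsewhere, then \<open>x \<bullet> (z /\<^sub>R norm z) = (a 0 + \<dots> + a (k - 1)) / sqrt k\<close>
  (\<open>signed_support_in_H2\<close>). So it is enough to find a \<open>k\<close> for which the sum of the \<open>k\<close> largest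
  values is at least \<open>\<tau> * sqrt k\<close>.

  Suppose there is none. The number \<open>\<tau> * sqrt k\<close> is the \<open>k\<close>-th partial sum of \<open>\<tau> * c i\<close>, where
  \<open>c i = sqrt (i + 1) - sqrt i\<close>. Since \<open>a\<close> is decreasing, an inequality between all
  partial sums survives weighting by \<open>a\<close> (\<open>weighted_sum_nonneg\<close>, which is summation by parts),
  and then the Cauchy-Schwarz inequality gives
  \<open>1 = \<Sum> (a i)\<^sup>2 \<le> \<tau> * \<Sum> a i * c i \<le> \<tau> * sqrt (\<Sum> (c i)\<^sup>2)\<close>.
  But \<open>(c 0)\<^sup>2 = 1\<close> and \<open>(c i)\<^sup>2 \<le> 1 / (4 * i)\<close> for \<open>i \<ge> 1\<close>, so comparing a harmonic sum with the
  logarithm yields \<open>\<Sum> (c i)\<^sup>2 \<le> (ln (n - 1) + 5) / 4\<close> (\<open>sum_sqrt_increment_squares_le\<close>), which is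
  less than \<open>1 / \<tau>\<^sup>2\<close> for \<open>\<tau> = 2 / sqrt (ln n + 5)\<close>: a contradiction.
\<close>

text \<open>
  Summation by parts writes the weighted sum as a combination of the partial sums of \<open>d\<close>, with
  the nonnegative coefficients \<open>w i - w (i + 1)\<close> and, for the last one, \<open>w (n - 1)\<close>.
\<close>

lemma weighted_sum_nonneg:
  fixes w d :: "nat \<Rightarrow> real"
  assumes decr: "\<And>i. Suc i < n \<Longrightarrow> w (Suc i) \<le> w i"
    and nonneg: "\<And>i. i < n \<Longrightarrow> 0 \<le> w i"
    and partial: "\<And>k. k \<le> n \<Longrightarrow> 0 \<le> (\<Sum>i<k. d i)"
  shows "0 \<le> (\<Sum>i<n. w i * d i)"
proof (cases n)
  case 0
  then show ?thesis by simp
next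
  case (Suc m)
  have "w k * (\<Sum>i<Suc k. d i) \<le> (\<Sum>i<Suc k. w i * d i)" if "k < n" for k
    using that
  proof (induction k)
    case 0
    then show ?case by simp
  next
    case (Suc k)
    have "w (Suc k) * (\<Sum>i<Suc k. d i) \<le> w k * (\<Sum>i<Suc k. d i)"
      using decr[of k] partial[of "Suc k"] Suc.prems by (intro mult_right_mono) auto
    also have "\<dots> \<le> (\<Sum>i<Suc k. w i * d i)"
      using Suc by simp
    finally show ?case
      by (simp add: algebra_simps)
  qed
  from this[of m] have "w m * (\<Sum>i<n. d i) \<le> (\<Sum>i<n. w i * d i)"
    using Suc by simp
  moreover have "0 \<le> w m * (\<Sum>i<n. d i)"
    using nonneg[of m] partial[of n] Suc by (intro mult_nonneg_nonneg) auto
  ultimately show ?thesis by simp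
qed

lemma sqrt_increment_square_le:
  fixes y :: real
  assumes "0 < y"
  shows "(sqrt (y + 1) - sqrt y)\<^sup>2 \<le> 1 / (4 * y)"
proof -
  have le: "sqrt y \<le> sqrt (y + 1)" and pos: "0 < sqrt y"
    using assms by simp_all
  have "(sqrt (y + 1) - sqrt y) * (2 * sqrt y) \<le> (sqrt (y + 1) - sqrt y) * (sqrt (y + 1) + sqrt y)"
    using le by (intro mult_left_mono) auto
  also have "\<dots> = 1"
    using assms by (simp add: algebra_simps)
  finally have "sqrt (y + 1) - sqrt y \<le> 1 / (2 * sqrt y)"
    using pos by (simp add: field_simps)
  then have "(sqrt (y + 1) - sqrt y)\<^sup>2 \<le> (1 / (2 * sqrt y))\<^sup>2"
    using le by (intro power_mono) auto
  also have "\<dots> = 1 / (4 * y)"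
    using assms by (simp add: power_divide power_mult_distrib)
  finally show ?thesis .
qed

text \<open>
  The first two terms are bounded by \<open>1\<close> and \<open>1 / 4\<close>; every later term \<open>i\<close> is at most
  \<open>1 / (4 * i) \<le> (ln i - ln (i - 1)) / 4\<close>, and these bounds telescope.
\<close>

lemma sum_sqrt_increment_squares_le:
  assumes "1 \<le> m"
  shows "(\<Sum>i<Suc m. (sqrt (real (Suc i)) - sqrt (real i))\<^sup>2) \<le> (ln (real m) + 5) / 4"
  using assms
proof (induction m rule: dec_induct)
  case base
  show ?case
    using sqrt_increment_square_le[of 1] by simp
next
  case (step m)
  then have m: "0 < real m" by simp
  have "ln (real m / real (Suc m)) \<le> real m / real (Suc m) - 1"
    using m by (intro ln_le_minus_one) simp
  also have "\<dots> = - (1 / real (Suc m))"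
    by (simp add: field_simps)
  finally have "1 / real (Suc m) \<le> ln (real (Suc m)) - ln (real m)"
    using m by (simp add: ln_div)
  then have "1 / (4 * real (Suc m)) \<le> (ln (real (Suc m)) - ln (real m)) / 4"
    by (simp add: field_simps)
  moreover have "(sqrt (real (Suc (Suc m))) - sqrt (real (Suc m)))\<^sup>2 \<le> 1 / (4 * real (Suc m))"
    using sqrt_increment_square_le[of "real (Suc m)"] by (simp add: add_ac)
  ultimately have "(sqrt (real (Suc (Suc m))) - sqrt (real (Suc m)))\<^sup>2
      \<le> (ln (real (Suc m)) - ln (real m)) / 4"
    by (rule order_trans[rotated])
  with step.IH have "(\<Sum>i<Suc (Suc m). (sqrt (real (Suc i)) - sqrt (real i))\<^sup>2)
      \<le> (ln (real m) + 5) / 4 + (ln (real (Suc m)) - ln (real m)) / 4"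
    unfolding sum.lessThan_Suc[of _ "Suc m"] by (rule add_mono)
  then show ?case
    by (simp only: flip: add_divide_distrib) simp
qed

text \<open>
  If all partial sums of \<open>a\<close> stayed below those of \<open>t * (sqrt (i + 1) - sqrt i)\<close>, which telescope
  to \<open>t * sqrt k\<close>, then weighting by \<open>a\<close> and the Cauchy-Schwarz inequality would make the sum of
  the squares of \<open>a\<close> less than \<open>1\<close>.
\<close>

lemma exists_large_partial_sum:
  fixes a :: "nat \<Rightarrow> real"
  assumes decr: "\<And>i. Suc i < n \<Longrightarrow> a (Suc i) \<le> a i"
    and nonneg: "\<And>i. i < n \<Longrightarrow> 0 \<le> a i"
    and unit: "(\<Sum>i<n. (a i)\<^sup>2) = 1"
    and small: "t\<^sup>2 * (\<Sum>i<n. (sqrt (real (Suc i)) - sqrt (real i))\<^sup>2) < 1"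
  shows "\<exists>k. 0 < k \<and> k \<le> n \<and> t * sqrt (real k) \<le> (\<Sum>i<k. a i)"
proof (rule ccontr)
  assume "\<not> ?thesis"
  then have less: "(\<Sum>i<k. a i) < t * sqrt (real k)" if "0 < k" "k \<le> n" for k
    using that by (meson not_le)
  define c where "c i = sqrt (real (Suc i)) - sqrt (real i)" for i
  have partial: "0 \<le> (\<Sum>i<k. t * c i - a i)" if "k \<le> n" for k
  proof -
    have "(\<Sum>i<k. c i) = sqrt (real k)"
      unfolding c_def by (subst sum_lessThan_telescope) simp
    then have "(\<Sum>i<k. t * c i - a i) = t * sqrt (real k) - (\<Sum>i<k. a i)"
      by (simp add: sum_subtractf flip: sum_distrib_left)
    then show ?thesis
      using less[of k] that by (cases "k = 0") auto
  qed
  have "0 \<le> (\<Sum>i<n. a i * (t * c i - a i))"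
    using decr nonneg partial by (rule weighted_sum_nonneg)
  also have "\<dots> = t * (\<Sum>i<n. a i * c i) - (\<Sum>i<n. (a i)\<^sup>2)"
    by (simp add: sum_subtractf sum_distrib_left algebra_simps power2_eq_square)
  finally have "1 \<le> t * (\<Sum>i<n. a i * c i)"
    using unit by simp
  then have "1 \<le> (t * (\<Sum>i<n. a i * c i))\<^sup>2"
    by (rule one_le_power)
  also have "\<dots> = t\<^sup>2 * (\<Sum>i<n. a i * c i)\<^sup>2"
    by (simp add: power_mult_distrib)
  also have "\<dots> \<le> t\<^sup>2 * ((\<Sum>i<n. (a i)\<^sup>2) * (\<Sum>i<n. (c i)\<^sup>2))"
    by (intro mult_left_mono Cauchy_Schwarz_ineq_sum) simp
  also have "\<dots> < 1"
    using small unit by (simp add: c_def)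
  finally show False by simp
qed

lemma exists_decreasing_enumeration:
  fixes f :: "'a::finite \<Rightarrow> real"
  shows "\<exists>\<sigma>. bij_betw \<sigma> {..<CARD('a)} UNIV \<and>
    (\<forall>i. Suc i < CARD('a) \<longrightarrow> f (\<sigma> (Suc i)) \<le> f (\<sigma> i))"
proof -
  obtain us :: "'a list" where us: "set us = UNIV" "distinct us"
    using finite_distinct_list[of "UNIV :: 'a set"] by auto
  define xs where "xs = sort_key (\<lambda>i. - f i) us"
  have xs: "set xs = UNIV" "distinct xs" "sorted (map (\<lambda>i. - f i) xs)"
    using us by (simp_all add: xs_def)
  have len: "length xs = CARD('a)"
    using distinct_card[OF xs(2)] xs(1) by simp
  have "bij_betw ((!) xs) {..<CARD('a)} UNIV"
    using xs len by (intro bij_betw_nth) auto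
  moreover have "f (xs ! Suc i) \<le> f (xs ! i)" if "Suc i < CARD('a)" for i
    using sorted_nth_mono[OF xs(3), of i "Suc i"] that len by simp
  ultimately show ?thesis by blast
qed

text \<open>
  The vector is the normalisation of the sign pattern of \<open>x\<close> on \<open>K\<close>. The sign of a zero
  coordinate is chosen as \<open>1\<close>, so that the pattern has norm \<open>sqrt (card K)\<close> in every case.
\<close>

lemma signed_support_in_H2:
  fixes x :: "real ^ 'n"
  assumes "K \<noteq> {}"
  shows "\<exists>v\<in>H2. x \<bullet> v = (\<Sum>i\<in>K. \<bar>x $ i\<bar>) / sqrt (real (card K))"
proof -
  define z :: "real ^ 'n" where
    "z = (\<chi> i. if i \<in> K then (if x $ i < 0 then -1 else 1) else 0)"
  have "(\<Sum>i\<in>UNIV. (z $ i)\<^sup>2) = (\<Sum>i\<in>UNIV. if i \<in> K then 1 else 0)"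
    by (intro sum.cong) (auto simp: z_def)
  then have norm_z: "norm z = sqrt (real (card K))"
    by (simp add: norm_vec_def L2_set_def sum.If_cases)
  have "x \<bullet> z = (\<Sum>i\<in>UNIV. if i \<in> K then \<bar>x $ i\<bar> else 0)"
    unfolding inner_vec_def by (intro sum.cong) (auto simp: z_def)
  then have "x \<bullet> z = (\<Sum>i\<in>K. \<bar>x $ i\<bar>)"
    by (simp add: sum.If_cases)
  then have "x \<bullet> (z /\<^sub>R norm z) = (\<Sum>i\<in>K. \<bar>x $ i\<bar>) / sqrt (real (card K))"
    by (simp add: norm_z divide_inverse)
  moreover have "norm z \<noteq> 0"
    using assms by (simp add: norm_z)
  then have "z /\<^sub>R norm z \<in> H2"
    unfolding H2_def by (intro CollectI exI[of _ z]) (simp add: z_def)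
  ultimately show ?thesis by blast
qed

lemma H2_finite_card:
  "finite (H2 :: (real ^ 'n) set)" "card (H2 :: (real ^ 'n) set) \<le> 3 ^ CARD('n)"
proof -
  define P where "P = (UNIV :: 'n set) \<rightarrow>\<^sub>E {-1, 0, 1 :: real}"
  define g :: "('n \<Rightarrow> real) \<Rightarrow> real ^ 'n" where "g f = vec_lambda f /\<^sub>R norm (vec_lambda f)" for f
  have fin: "finite P"
    unfolding P_def by (intro finite_PiE) auto
  have "card P = 3 ^ CARD('n)"
    unfolding P_def by (subst card_PiE) (simp_all add: numeral_3_eq_3)
  have sub: "H2 \<subseteq> g ` P"
  proof
    fix v :: "real ^ 'n" assume "v \<in> H2"
    then obtain z where z: "\<forall>i. z $ i \<in> {-1, 0, 1}" and v: "v = z /\<^sub>R norm z"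
      unfolding H2_def by auto
    have "($) z \<in> P" using z by (auto simp: P_def)
    moreover have "v = g (($) z)" by (simp add: g_def v)
    ultimately show "v \<in> g ` P" by blast
  qed
  show "finite (H2 :: (real ^ 'n) set)"
    using sub fin by (meson finite_imageI finite_subset)
  have "card (H2 :: (real ^ 'n) set) \<le> card P"
    using sub fin by (rule surj_card_le[rotated])
  then show "card (H2 :: (real ^ 'n) set) \<le> 3 ^ CARD('n)"
    using \<open>card P = _\<close> by simp
qed

theorem corollary2p7:
  assumes "CARD('n::finite) \<ge> 2"
  shows "(H2 :: (real ^ 'n) set)
           \<in> hitting_sets (2 / sqrt (ln (real CARD('n)) + 5)) (3 ^ CARD('n))"
proof -
  let ?n = "CARD('n)"
  define t where "t = 2 / sqrt (ln (real ?n) + 5)"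
  have "0 \<le> ln (real ?n)"
    using assms by simp
  then have pos: "0 < ln (real ?n) + 5"
    by (rule add_nonneg_pos) simp
  have small: "t\<^sup>2 * (\<Sum>i<?n. (sqrt (real (Suc i)) - sqrt (real i))\<^sup>2) < 1"
  proof -
    have "(\<Sum>i<?n. (sqrt (real (Suc i)) - sqrt (real i))\<^sup>2) \<le> (ln (real (?n - 1)) + 5) / 4"
      using sum_sqrt_increment_squares_le[of "?n - 1"] assms by simp
    also have "\<dots> < (ln (real ?n) + 5) / 4"
      using assms by simp
    finally have "(\<Sum>i<?n. (sqrt (real (Suc i)) - sqrt (real i))\<^sup>2) < (ln (real ?n) + 5) / 4" .
    moreover have "0 < t"
      using pos by (simp add: t_def)
    ultimately have "t\<^sup>2 * (\<Sum>i<?n. (sqrt (real (Suc i)) - sqrt (real i))\<^sup>2)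
        < t\<^sup>2 * ((ln (real ?n) + 5) / 4)"
      by (intro mult_strict_left_mono) simp_all
    also have "\<dots> = 1"
      using pos by (simp add: t_def power_divide)
    finally show ?thesis .
  qed
  have hit: "\<exists>v\<in>H2. t \<le> x \<bullet> v" if "norm x = 1" for x :: "real ^ 'n"
  proof -
    obtain \<sigma> :: "nat \<Rightarrow> 'n" where bij: "bij_betw \<sigma> {..<?n} UNIV"
      and decr: "\<And>i. Suc i < ?n \<Longrightarrow> \<bar>x $ \<sigma> (Suc i)\<bar> \<le> \<bar>x $ \<sigma> i\<bar>"
      using exists_decreasing_enumeration[of "\<lambda>i. \<bar>x $ i\<bar>"] by blast
    have "(\<Sum>i<?n. \<bar>x $ \<sigma> i\<bar>\<^sup>2) = (\<Sum>i\<in>UNIV. \<bar>x $ i\<bar>\<^sup>2)"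
      using bij by (rule sum.reindex_bij_betw)
    also have "\<dots> = 1"
      using that by (simp add: norm_vec_def L2_set_def)
    finally have "\<exists>k. 0 < k \<and> k \<le> ?n \<and> t * sqrt (real k) \<le> (\<Sum>i<k. \<bar>x $ \<sigma> i\<bar>)"
      using decr small by (intro exists_large_partial_sum) auto
    then obtain k where k: "0 < k" "k \<le> ?n" "t * sqrt (real k) \<le> (\<Sum>i<k. \<bar>x $ \<sigma> i\<bar>)"
      by blast
    have inj: "inj_on \<sigma> {..<k}"
      using bij k(2) by (auto simp: bij_betw_def intro: inj_on_subset)
    obtain v where "v \<in> H2"
      and v: "x \<bullet> v = (\<Sum>i\<in>\<sigma> ` {..<k}. \<bar>x $ i\<bar>) / sqrt (real (card (\<sigma> ` {..<k})))"
      using signed_support_in_H2[of "\<sigma> ` {..<k}" x] k(1) by auto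
    have "x \<bullet> v = (\<Sum>i<k. \<bar>x $ \<sigma> i\<bar>) / sqrt (real k)"
      using inj by (simp add: v sum.reindex card_image)
    then have "t \<le> x \<bullet> v"
      using k(1,3) by (simp add: pos_le_divide_eq)
    with \<open>v \<in> H2\<close> show ?thesis by blast
  qed
  have "(H2 :: (real ^ 'n) set) \<subseteq> sphere 0 1"
    by (auto simp: H2_def)
  moreover have "(\<Union>v\<in>H2. sphere_cap v t) = sphere (0 :: real ^ 'n) 1"
    using hit by (force simp: sphere_cap_def)
  ultimately show ?thesis
    using H2_finite_card unfolding hitting_sets_def hitting_set_def t_def by blast
qed

end
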